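(* Let $G$ be a group with neutral element $e$. For a fuzzy subgroup $\mu$ of $G$ let $\sigma(\mu):(0,1]\to\{\text{subgroups of }G\}$ be defined by $\sigma(\mu)(\alpha)=\{x\in G\mid \mu^1(x)\geq\alpha\}$. Then the assignment $[\mu]\mapsto\sigma(\mu)$ is well defined on $\sim$-equivalence classes of fuzzy subgroups and is a bijection from the set of all $\sim$-equivalence classes of fuzzy subgroups of $G$ onto the set of all decreasing gradual subgroups of $G$ satisfying property (F). Its inverse sends a decreasing gradual subgroup $\sigma$ with property (F) to the class $[\mu(\sigma)]$, where $\mu(\sigma)(e)=1$ and, for $x\neq e$, $\mu(\sigma)(x)=\max\{\gamma\in(0,1]\mid x\in\sigma(\gamma)\}$ if $x\in\bigcup_{\alpha\in(0,1]}\sigma(\alpha)$ and $\mu(\sigma)(x)=0$ otherwise.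
   Context: A fuzzy subgroup of a group $G$ is a map $\mu:G\to[0,1]$, not constantly equal to $0$, such that $\mu(xy^{-1})\geq\min(\mu(x),\mu(y))$ for all $x,y\in G$. Two fuzzy subgroups are equivalent, $\mu_1\sim\mu_2$, if $\mu_1(x)=\mu_2(x)$ for all $x\neq e$. For a fuzzy subgroup $\mu$, $\mu^1$ is the map with $\mu^1(e)=1$ and $\mu^1(x)=\mu(x)$ for $x\neq e$. A gradual subgroup of $G$ is a map $\sigma$ from $(0,1]$ to the set of subgroups of $G$; it is decreasing if $\sigma(\beta)\subseteq\sigma(\alpha)$ whenever $\alpha\leq\beta$. A decreasing gradual subgroup $\sigma$ satisfies property (F) if for every $x\in\bigcup_{\alpha\in(0,1]}\sigma(\alpha)$ the set $\{\alpha\in(0,1]\mid x\in\sigma(\alpha)\}$ has a maximum. *)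

theory Defs
  imports Complex_Main "HOL-Algebra.Coset" "HOL-Library.FuncSet"
begin

text \<open>Maps out of the carrier of \<open>G\<close> and out of \<open>(0,1]\<close> are extensional
  (\<open>\<rightarrow>\<^sub>E\<close>), so that equality of HOL functions is equality of maps on these domains.\<close>

definition fuzzy_subgroup :: "('a, 'b) monoid_scheme \<Rightarrow> ('a \<Rightarrow> real) \<Rightarrow> bool" where
  "fuzzy_subgroup G \<mu> \<longleftrightarrow>
     \<mu> \<in> carrier G \<rightarrow>\<^sub>E {0..1} \<and>
     (\<exists>x\<in>carrier G. \<mu> x \<noteq> 0) \<and>
     (\<forall>x\<in>carrier G. \<forall>y\<in>carrier G. \<mu> (x \<otimes>\<^bsub>G\<^esub> inv\<^bsub>G\<^esub> y) \<ge> min (\<mu> x) (\<mu> y))"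

definition fuzzy_subgroups :: "('a, 'b) monoid_scheme \<Rightarrow> ('a \<Rightarrow> real) set" where
  "fuzzy_subgroups G = {\<mu>. fuzzy_subgroup G \<mu>}"

definition fuzzy_equiv :: "('a, 'b) monoid_scheme \<Rightarrow> ('a \<Rightarrow> real) rel" where
  "fuzzy_equiv G = {(\<mu>1, \<mu>2). fuzzy_subgroup G \<mu>1 \<and> fuzzy_subgroup G \<mu>2 \<and>
     (\<forall>x\<in>carrier G. x \<noteq> \<one>\<^bsub>G\<^esub> \<longrightarrow> \<mu>1 x = \<mu>2 x)}"

definition fuzzy_class :: "('a, 'b) monoid_scheme \<Rightarrow> ('a \<Rightarrow> real) \<Rightarrow> ('a \<Rightarrow> real) set" where
  "fuzzy_class G \<mu> = fuzzy_equiv G `` {\<mu>}"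

definition normalize_at_one :: "('a, 'b) monoid_scheme \<Rightarrow> ('a \<Rightarrow> real) \<Rightarrow> 'a \<Rightarrow> real" where
  "normalize_at_one G \<mu> = \<mu>(\<one>\<^bsub>G\<^esub> := 1)"

definition gradual_subgroup :: "('a, 'b) monoid_scheme \<Rightarrow> (real \<Rightarrow> 'a set) \<Rightarrow> bool" where
  "gradual_subgroup G \<sigma> \<longleftrightarrow> \<sigma> \<in> {0<..1} \<rightarrow>\<^sub>E {H. subgroup H G}"

definition decreasing_gradual :: "(real \<Rightarrow> 'a set) \<Rightarrow> bool" where
  "decreasing_gradual \<sigma> \<longleftrightarrow>
     (\<forall>\<alpha>\<in>{0<..1}. \<forall>\<beta>\<in>{0<..1}. \<alpha> \<le> \<beta> \<longrightarrow> \<sigma> \<beta> \<subseteq> \<sigma> \<alpha>)"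

definition has_maximum :: "real set \<Rightarrow> bool" where
  "has_maximum S \<longleftrightarrow> (\<exists>m\<in>S. \<forall>s\<in>S. s \<le> m)"

definition property_F :: "(real \<Rightarrow> 'a set) \<Rightarrow> bool" where
  "property_F \<sigma> \<longleftrightarrow>
     (\<forall>x\<in>(\<Union>\<alpha>\<in>{0<..1}. \<sigma> \<alpha>). has_maximum {\<alpha>\<in>{0<..1}. x \<in> \<sigma> \<alpha>})"

definition decreasing_F_gradual_subgroups ::
    "('a, 'b) monoid_scheme \<Rightarrow> (real \<Rightarrow> 'a set) set" where
  "decreasing_F_gradual_subgroups G =
     {\<sigma>. gradual_subgroup G \<sigma> \<and> decreasing_gradual \<sigma> \<and> property_F \<sigma>}"

definition fuzzy_to_gradual :: "('a, 'b) monoid_scheme \<Rightarrow> ('a \<Rightarrow> real) \<Rightarrow> real \<Rightarrow> 'a set" where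
  "fuzzy_to_gradual G \<mu> =
     (\<lambda>\<alpha>\<in>{0<..1}. {x\<in>carrier G. normalize_at_one G \<mu> x \<ge> \<alpha>})"

text \<open>The induced map on equivalence classes. The image of a class is a singleton exactly
  when the map does not depend on the representative; otherwise \<open>the_elem\<close> is unspecified.\<close>

definition class_to_gradual ::
    "('a, 'b) monoid_scheme \<Rightarrow> ('a \<Rightarrow> real) set \<Rightarrow> real \<Rightarrow> 'a set" where
  "class_to_gradual G C = the_elem (fuzzy_to_gradual G ` C)"

text \<open>\<open>Max\<close> is only meaningful for finite sets, hence \<open>GREATEST\<close>.\<close>

definition gradual_to_fuzzy :: "('a, 'b) monoid_scheme \<Rightarrow> (real \<Rightarrow> 'a set) \<Rightarrow> 'a \<Rightarrow> real" where
  "gradual_to_fuzzy G \<sigma> =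
     (\<lambda>x\<in>carrier G.
        if x = \<one>\<^bsub>G\<^esub> then 1
        else if x \<in> (\<Union>\<alpha>\<in>{0<..1}. \<sigma> \<alpha>) then (GREATEST \<gamma>. \<gamma> \<in> {0<..1} \<and> x \<in> \<sigma> \<gamma>)
        else 0)"

end

(* A fuzzy subgroup, normalized to take the value 1 at the neutral element, is encoded by its
   level sets: for 0 < \<alpha> \<le> 1, the element x lies in \<sigma>(\<alpha>) iff \<alpha> \<le> \<mu>\<^sup>1(x).  Hence \<mu>\<^sup>1(x) is the
   largest \<alpha> with x \<in> \<sigma>(\<alpha>) (or 0), which recovers \<mu> away from e and gives property (F).  Conversely
   property (F) is what turns the pointwise maximum of a decreasing family into a function with
   exactly these level sets. *)
theory Submission
  imports Defs
begin

section \<open>Level sets of a normalized fuzzy subgroup\<close>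

lemma fuzzy_subgroup_range:
  assumes "fuzzy_subgroup G \<mu>" "x \<in> carrier G"
  shows "0 \<le> \<mu> x" "\<mu> x \<le> 1"
  using assms unfolding fuzzy_subgroup_def by (auto dest: PiE_mem)

lemma (in group) fuzzy_subgroup_le_one:
  assumes "fuzzy_subgroup G \<mu>" "x \<in> carrier G"
  shows "\<mu> x \<le> \<mu> \<one>"
proof -
  have "min (\<mu> x) (\<mu> x) \<le> \<mu> (x \<otimes> inv x)"
    using assms unfolding fuzzy_subgroup_def by blast
  then show ?thesis
    using assms(2) by simp
qed

text \<open>Only quotients involving the neutral element are affected. Since \<mu> is already
  largest there, raising that value to 1 does not change a minimum in which the other argument is
  not neutral.\<close>

lemma (in group) fuzzy_subgroup_normalize_at_one:
  assumes \<mu>: "fuzzy_subgroup G \<mu>"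
  shows "fuzzy_subgroup G (normalize_at_one G \<mu>)"
proof -
  let ?\<nu> = "normalize_at_one G \<mu>"
  have le: "?\<nu> z \<le> 1" if "z \<in> carrier G" for z
    using fuzzy_subgroup_range(2)[OF \<mu> that] by (simp add: normalize_at_one_def)
  have "min (?\<nu> x) (?\<nu> y) \<le> ?\<nu> (x \<otimes> inv y)"
    if x: "x \<in> carrier G" and y: "y \<in> carrier G" for x y
  proof (cases "x \<otimes> inv y = \<one>")
    case True
    then show ?thesis
      using le[OF x] by (simp add: normalize_at_one_def min.coboundedI1)
  next
    case False
    then have ne: "\<not> (x = \<one> \<and> y = \<one>)"
      by auto
    \<comment> \<open>At most one of x and y is neutral; the value at the other one is then the
      minimum, both before and after normalization.\<close>
    have "min (?\<nu> x) (?\<nu> y) \<le> min (\<mu> x) (\<mu> y)"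
      using ne fuzzy_subgroup_le_one[OF \<mu> x] fuzzy_subgroup_le_one[OF \<mu> y]
      by (auto simp: normalize_at_one_def min_le_iff_disj)
    also have "\<dots> \<le> \<mu> (x \<otimes> inv y)"
      using \<mu> x y unfolding fuzzy_subgroup_def by blast
    finally show ?thesis
      using False by (simp add: normalize_at_one_def)
  qed
  moreover have "?\<nu> \<in> carrier G \<rightarrow>\<^sub>E {0..1}"
    using \<mu> unfolding fuzzy_subgroup_def normalize_at_one_def
    by (auto simp: PiE_iff extensional_def)
  moreover have "\<exists>x\<in>carrier G. ?\<nu> x \<noteq> 0"
    by (rule bexI[of _ \<one>]) (simp_all add: normalize_at_one_def)
  ultimately show ?thesis
    unfolding fuzzy_subgroup_def by blast
qed

text \<open>The bound on \<alpha> puts the neutral element into the level set. Closure under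
  quotients is the defining inequality; inverses are quotients of \<open>\<one>\<close>, and
  products are quotients by an inverse.\<close>

lemma (in group) fuzzy_subgroup_level_set:
  assumes \<nu>: "fuzzy_subgroup G \<nu>" and \<alpha>: "\<alpha> \<le> \<nu> \<one>"
  shows "subgroup {x \<in> carrier G. \<alpha> \<le> \<nu> x} G"
proof (rule group.subgroupI[OF is_group])
  have div: "\<alpha> \<le> \<nu> (x \<otimes> inv y)"
    if "x \<in> carrier G" "\<alpha> \<le> \<nu> x" "y \<in> carrier G" "\<alpha> \<le> \<nu> y" for x y
  proof -
    have "\<alpha> \<le> min (\<nu> x) (\<nu> y)"
      using that by simp
    also have "\<dots> \<le> \<nu> (x \<otimes> inv y)"
      using \<nu> that unfolding fuzzy_subgroup_def by blast
    finally show ?thesis .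
  qed
  have inv: "\<alpha> \<le> \<nu> (inv y)" if "y \<in> carrier G" "\<alpha> \<le> \<nu> y" for y
    using div[of \<one> y] that \<alpha> by simp
  show "{x \<in> carrier G. \<alpha> \<le> \<nu> x} \<noteq> {}"
    using \<alpha> by blast
  show "inv a \<in> {x \<in> carrier G. \<alpha> \<le> \<nu> x}" if "a \<in> {x \<in> carrier G. \<alpha> \<le> \<nu> x}" for a
    using that inv by simp
  show "a \<otimes> b \<in> {x \<in> carrier G. \<alpha> \<le> \<nu> x}"
    if "a \<in> {x \<in> carrier G. \<alpha> \<le> \<nu> x}" "b \<in> {x \<in> carrier G. \<alpha> \<le> \<nu> x}" for a b
    using that div[of a "inv b"] inv by simp
qed auto

lemma mem_fuzzy_to_gradual_iff:
  assumes "\<alpha> \<in> {0<..1}"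
  shows "x \<in> fuzzy_to_gradual G \<mu> \<alpha> \<longleftrightarrow> x \<in> carrier G \<and> \<alpha> \<le> normalize_at_one G \<mu> x"
  using assms by (simp add: fuzzy_to_gradual_def)

lemma (in group) fuzzy_to_gradual_in_decreasing_F_gradual_subgroups:
  assumes \<mu>: "fuzzy_subgroup G \<mu>"
  shows "fuzzy_to_gradual G \<mu> \<in> decreasing_F_gradual_subgroups G"
proof -
  let ?\<nu> = "normalize_at_one G \<mu>"
  have \<nu>: "fuzzy_subgroup G ?\<nu>"
    by (rule fuzzy_subgroup_normalize_at_one[OF \<mu>])
  have "gradual_subgroup G (fuzzy_to_gradual G \<mu>)"
    unfolding gradual_subgroup_def fuzzy_to_gradual_def
    using fuzzy_subgroup_level_set[OF \<nu>] by (auto simp: normalize_at_one_def)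
  moreover have "decreasing_gradual (fuzzy_to_gradual G \<mu>)"
    unfolding decreasing_gradual_def by (auto simp: fuzzy_to_gradual_def)
  moreover have "property_F (fuzzy_to_gradual G \<mu>)"
    unfolding property_F_def has_maximum_def
  proof
    fix x assume "x \<in> (\<Union>\<alpha>\<in>{0<..1}. fuzzy_to_gradual G \<mu> \<alpha>)"
    then obtain \<alpha> where "0 < \<alpha>" "x \<in> carrier G" "\<alpha> \<le> ?\<nu> x"
      by (auto simp: mem_fuzzy_to_gradual_iff)
    \<comment> \<open>The levels containing x form the interval from 0 (excluded) to
      \<open>?\<nu> x\<close> (included), so this value is the maximum that property (F) asks
      for.\<close>
    moreover from this have "?\<nu> x \<in> {0<..1}"
      using fuzzy_subgroup_range[OF \<nu>] by force
    ultimately show "\<exists>m\<in>{\<alpha> \<in> {0<..1}. x \<in> fuzzy_to_gradual G \<mu> \<alpha>}.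
        \<forall>s\<in>{\<alpha> \<in> {0<..1}. x \<in> fuzzy_to_gradual G \<mu> \<alpha>}. s \<le> m"
      by (intro bexI[of _ "?\<nu> x"]) (auto simp: mem_fuzzy_to_gradual_iff)
  qed
  ultimately show ?thesis
    by (simp add: decreasing_F_gradual_subgroups_def)
qed

section \<open>Equivalence as equality of level sets\<close>

text \<open>Compare the level sets at the level \<open>\<mu>1 x\<close> itself. The value 0 is not a
  level, but there nonnegativity of \<open>\<mu>2\<close> suffices. Exchanging the roles of the two
  maps gives equality.\<close>

lemma fuzzy_le_if_gradual_eq:
  assumes \<mu>1: "fuzzy_subgroup G \<mu>1" and \<mu>2: "fuzzy_subgroup G \<mu>2"
    and eq: "fuzzy_to_gradual G \<mu>1 = fuzzy_to_gradual G \<mu>2"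
    and x: "x \<in> carrier G" "x \<noteq> \<one>\<^bsub>G\<^esub>"
  shows "\<mu>1 x \<le> \<mu>2 x"
proof (cases "\<mu>1 x = 0")
  case True
  then show ?thesis
    using fuzzy_subgroup_range(1)[OF \<mu>2 x(1)] by simp
next
  case False
  then have \<alpha>: "\<mu>1 x \<in> {0<..1}"
    using fuzzy_subgroup_range[OF \<mu>1 x(1)] by simp
  then have "x \<in> fuzzy_to_gradual G \<mu>1 (\<mu>1 x)"
    using x by (simp add: fuzzy_to_gradual_def normalize_at_one_def)
  then have "x \<in> fuzzy_to_gradual G \<mu>2 (\<mu>1 x)"
    by (simp add: eq)
  then show ?thesis
    using x \<alpha> by (simp add: mem_fuzzy_to_gradual_iff normalize_at_one_def)
qed

text \<open>The equivalence is thus the kernel of \<open>fuzzy_to_gradual\<close> on fuzzy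
  subgroups. That it is an equivalence relation, that the induced map is well defined and that it is
  injective all follow from this form.\<close>

lemma fuzzy_equiv_iff:
  "(\<mu>1, \<mu>2) \<in> fuzzy_equiv G \<longleftrightarrow>
     fuzzy_subgroup G \<mu>1 \<and> fuzzy_subgroup G \<mu>2 \<and> fuzzy_to_gradual G \<mu>1 = fuzzy_to_gradual G \<mu>2"
proof -
  have "fuzzy_to_gradual G \<mu>1 = fuzzy_to_gradual G \<mu>2"
    if "\<forall>x\<in>carrier G. x \<noteq> \<one>\<^bsub>G\<^esub> \<longrightarrow> \<mu>1 x = \<mu>2 x"
  proof -
    have "normalize_at_one G \<mu>1 x = normalize_at_one G \<mu>2 x" if "x \<in> carrier G" for x
      using that \<open>\<forall>x\<in>carrier G. x \<noteq> \<one>\<^bsub>G\<^esub> \<longrightarrow> \<mu>1 x = \<mu>2 x\<close>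
      by (simp add: normalize_at_one_def)
    then show ?thesis
      by (auto simp: fuzzy_to_gradual_def fun_eq_iff)
  qed
  moreover have "\<mu>1 x = \<mu>2 x"
    if "fuzzy_subgroup G \<mu>1" "fuzzy_subgroup G \<mu>2"
      and eq: "fuzzy_to_gradual G \<mu>1 = fuzzy_to_gradual G \<mu>2"
      and "x \<in> carrier G" "x \<noteq> \<one>\<^bsub>G\<^esub>" for x
    by (rule order.antisym) (use that eq[symmetric] in \<open>blast intro: fuzzy_le_if_gradual_eq\<close>)+
  ultimately show ?thesis
    unfolding fuzzy_equiv_def by blast
qed

lemma equiv_fuzzy_equiv: "equiv (fuzzy_subgroups G) (fuzzy_equiv G)"
  by (rule equivI)
     (auto simp: fuzzy_subgroups_def fuzzy_equiv_iff intro!: refl_onI symI transI)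

lemma fuzzy_to_gradual_respects: "fuzzy_to_gradual G respects fuzzy_equiv G"
  by (rule congruentI) (simp add: fuzzy_equiv_iff)

lemma class_to_gradual_fuzzy_class:
  assumes "fuzzy_subgroup G \<mu>"
  shows "class_to_gradual G (fuzzy_class G \<mu>) = fuzzy_to_gradual G \<mu>"
proof -
  have "fuzzy_to_gradual G ` fuzzy_class G \<mu> = {fuzzy_to_gradual G \<mu>}"
    using assms by (auto simp: fuzzy_class_def fuzzy_equiv_iff)
  then show ?thesis
    by (simp add: class_to_gradual_def)
qed

section \<open>Fuzzy subgroups from decreasing families with property (F)\<close>

text \<open>Property (F) supplies an attained maximum, which identifies the value of
  \<open>GREATEST\<close>.\<close>

lemma gradual_to_fuzzy_maximum:
  assumes \<sigma>: "property_F \<sigma>" and x: "x \<in> carrier G" "x \<noteq> \<one>\<^bsub>G\<^esub>"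
    and \<alpha>: "\<alpha> \<in> {0<..1}" "x \<in> \<sigma> \<alpha>"
  shows "gradual_to_fuzzy G \<sigma> x \<in> {0<..1}" "x \<in> \<sigma> (gradual_to_fuzzy G \<sigma> x)"
    "\<alpha> \<le> gradual_to_fuzzy G \<sigma> x"
proof -
  have Un: "x \<in> (\<Union>\<alpha>\<in>{0<..1}. \<sigma> \<alpha>)"
    using \<alpha> by blast
  then obtain m where m: "m \<in> {0<..1}" "x \<in> \<sigma> m"
    and max: "\<And>s. s \<in> {0<..1} \<Longrightarrow> x \<in> \<sigma> s \<Longrightarrow> s \<le> m"
    using \<sigma> unfolding property_F_def has_maximum_def by blast
  have "(GREATEST \<gamma>. \<gamma> \<in> {0<..1} \<and> x \<in> \<sigma> \<gamma>) = m"
    by (rule Greatest_equality) (use m max in auto)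
  then have "gradual_to_fuzzy G \<sigma> x = m"
    unfolding gradual_to_fuzzy_def using Un x by auto
  then show "gradual_to_fuzzy G \<sigma> x \<in> {0<..1}" "x \<in> \<sigma> (gradual_to_fuzzy G \<sigma> x)"
    "\<alpha> \<le> gradual_to_fuzzy G \<sigma> x"
    using m max \<alpha> by auto
qed

lemma gradual_to_fuzzy_eq_0:
  assumes "x \<in> carrier G" "x \<noteq> \<one>\<^bsub>G\<^esub>" "x \<notin> (\<Union>\<alpha>\<in>{0<..1}. \<sigma> \<alpha>)"
  shows "gradual_to_fuzzy G \<sigma> x = 0"
  unfolding gradual_to_fuzzy_def using assms by auto

text \<open>The level sets of the reconstructed map are the given subgroups. A level at which x
  occurs is bounded by the maximum; conversely x occurs at the maximum, hence at every smaller level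
  because \<sigma> decreases. At the neutral element both sides always hold.\<close>

lemma le_gradual_to_fuzzy_iff:
  assumes \<sigma>: "gradual_subgroup G \<sigma>" "decreasing_gradual \<sigma>" "property_F \<sigma>"
    and \<alpha>: "\<alpha> \<in> {0<..1}" and x: "x \<in> carrier G"
  shows "\<alpha> \<le> gradual_to_fuzzy G \<sigma> x \<longleftrightarrow> x \<in> \<sigma> \<alpha>"
proof (cases "x = \<one>\<^bsub>G\<^esub>")
  case True
  have "subgroup (\<sigma> \<alpha>) G"
    using \<sigma>(1) \<alpha> unfolding gradual_subgroup_def by auto
  then have "\<one>\<^bsub>G\<^esub> \<in> \<sigma> \<alpha>"
    by (rule subgroup.one_closed)
  then show ?thesis
    using True \<alpha> x by (simp add: gradual_to_fuzzy_def)
next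
  case False
  show ?thesis
  proof
    assume le: "\<alpha> \<le> gradual_to_fuzzy G \<sigma> x"
    \<comment> \<open>The value 0 is the default outside the union; the positive level \<alpha>
      excludes this case.\<close>
    then have "gradual_to_fuzzy G \<sigma> x \<noteq> 0"
      using \<alpha> by auto
    then obtain \<beta> where "\<beta> \<in> {0<..1}" "x \<in> \<sigma> \<beta>"
      using gradual_to_fuzzy_eq_0[OF x False] by blast
    note gradual_to_fuzzy_maximum(1,2)[OF \<sigma>(3) x False this]
    then show "x \<in> \<sigma> \<alpha>"
      using \<sigma>(2) \<alpha> le unfolding decreasing_gradual_def by blast
  next
    assume "x \<in> \<sigma> \<alpha>"
    then show "\<alpha> \<le> gradual_to_fuzzy G \<sigma> x"
      using gradual_to_fuzzy_maximum(3)[OF \<sigma>(3) x False \<alpha>] by blast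
  qed
qed

lemma gradual_to_fuzzy_range:
  assumes "property_F \<sigma>" and x: "x \<in> carrier G"
  shows "gradual_to_fuzzy G \<sigma> x \<in> {0..1}"
proof (cases "x \<noteq> \<one>\<^bsub>G\<^esub> \<and> x \<in> (\<Union>\<alpha>\<in>{0<..1}. \<sigma> \<alpha>)")
  case True
  then show ?thesis
    using gradual_to_fuzzy_maximum(1)[OF assms] by fastforce
next
  case False
  then show ?thesis
    using x gradual_to_fuzzy_eq_0[OF x, of \<sigma>] by (auto simp: gradual_to_fuzzy_def)
qed

lemma (in group) fuzzy_subgroup_gradual_to_fuzzy:
  assumes \<sigma>: "gradual_subgroup G \<sigma>" "decreasing_gradual \<sigma>" "property_F \<sigma>"
  shows "fuzzy_subgroup G (gradual_to_fuzzy G \<sigma>)"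
proof -
  let ?\<mu> = "gradual_to_fuzzy G \<sigma>"
  have range: "?\<mu> x \<in> {0..1}" if "x \<in> carrier G" for x
    using gradual_to_fuzzy_range[OF \<sigma>(3) that] .
  have "min (?\<mu> x) (?\<mu> y) \<le> ?\<mu> (x \<otimes> inv y)"
    if x: "x \<in> carrier G" and y: "y \<in> carrier G" for x y
  proof (cases "min (?\<mu> x) (?\<mu> y) = 0")
    case True
    then show ?thesis
      using range[of "x \<otimes> inv y"] x y by simp
  next
    case False
    \<comment> \<open>At this level both x and y lie in the subgroup
      \<open>\<sigma> \<alpha>\<close>, so their quotient does too, and its value is at least
      \<alpha>.\<close>
    define \<alpha> where "\<alpha> = min (?\<mu> x) (?\<mu> y)"
    have \<alpha>: "\<alpha> \<in> {0<..1}"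
      using False range[OF x] range[OF y] by (auto simp: \<alpha>_def min_def split: if_splits)
    have "x \<in> \<sigma> \<alpha>" "y \<in> \<sigma> \<alpha>"
      using le_gradual_to_fuzzy_iff[OF \<sigma> \<alpha> x] le_gradual_to_fuzzy_iff[OF \<sigma> \<alpha> y]
      by (auto simp: \<alpha>_def)
    moreover have "subgroup (\<sigma> \<alpha>) G"
      using \<sigma>(1) \<alpha> unfolding gradual_subgroup_def by auto
    ultimately have "x \<otimes> inv y \<in> \<sigma> \<alpha>"
      by (simp add: subgroup.m_closed subgroup.m_inv_closed)
    then show ?thesis
      using le_gradual_to_fuzzy_iff[OF \<sigma> \<alpha>, of "x \<otimes> inv y"] x y by (simp add: \<alpha>_def)
  qed
  moreover have "?\<mu> \<in> carrier G \<rightarrow>\<^sub>E {0..1}"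
    using range by (auto simp: PiE_iff gradual_to_fuzzy_def)
  moreover have "\<exists>x\<in>carrier G. ?\<mu> x \<noteq> 0"
    by (rule bexI[of _ \<one>]) (simp_all add: gradual_to_fuzzy_def)
  ultimately show ?thesis
    unfolding fuzzy_subgroup_def by blast
qed

lemma (in group) fuzzy_to_gradual_gradual_to_fuzzy:
  assumes \<sigma>: "gradual_subgroup G \<sigma>" "decreasing_gradual \<sigma>" "property_F \<sigma>"
  shows "fuzzy_to_gradual G (gradual_to_fuzzy G \<sigma>) = \<sigma>"
proof (rule extensionalityI[where A = "{0<..1}"])
  show "fuzzy_to_gradual G (gradual_to_fuzzy G \<sigma>) \<in> extensional {0<..1}"
    by (simp add: fuzzy_to_gradual_def)
  show "\<sigma> \<in> extensional {0<..1}"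
    using \<sigma>(1) by (simp add: gradual_subgroup_def PiE_iff)
  fix \<alpha> :: real assume \<alpha>: "\<alpha> \<in> {0<..1}"
  \<comment> \<open>The reconstructed map already takes the value 1 at the neutral element, so its
    level sets can be read off without normalizing.\<close>
  have "normalize_at_one G (gradual_to_fuzzy G \<sigma>) = gradual_to_fuzzy G \<sigma>"
    by (auto simp: normalize_at_one_def gradual_to_fuzzy_def fun_eq_iff)
  moreover have "\<sigma> \<alpha> \<subseteq> carrier G"
    using \<sigma>(1) \<alpha> unfolding gradual_subgroup_def by (auto dest!: PiE_mem subgroup.subset)
  ultimately show "fuzzy_to_gradual G (gradual_to_fuzzy G \<sigma>) \<alpha> = \<sigma> \<alpha>"
    using le_gradual_to_fuzzy_iff[OF \<sigma> \<alpha>] by (auto simp: mem_fuzzy_to_gradual_iff[OF \<alpha>])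
qed

theorem mainTheorem1:
  fixes G :: "('a, 'b) monoid_scheme"
  assumes "group G"
  shows "equiv (fuzzy_subgroups G) (fuzzy_equiv G) \<and>
    fuzzy_to_gradual G respects fuzzy_equiv G \<and>
    (\<forall>\<mu>\<in>fuzzy_subgroups G. class_to_gradual G (fuzzy_class G \<mu>) = fuzzy_to_gradual G \<mu>) \<and>
    bij_betw (class_to_gradual G)
      (fuzzy_subgroups G // fuzzy_equiv G) (decreasing_F_gradual_subgroups G) \<and>
    (\<forall>\<sigma>\<in>decreasing_F_gradual_subgroups G.
       gradual_to_fuzzy G \<sigma> \<in> fuzzy_subgroups G \<and>
       inv_into (fuzzy_subgroups G // fuzzy_equiv G) (class_to_gradual G) \<sigma>
         = fuzzy_class G (gradual_to_fuzzy G \<sigma>))"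
proof -
  interpret group G by fact
  let ?Q = "fuzzy_subgroups G // fuzzy_equiv G"
  let ?D = "decreasing_F_gradual_subgroups G"
  have class_cases: "\<exists>\<mu>. fuzzy_subgroup G \<mu> \<and> C = fuzzy_class G \<mu>" if "C \<in> ?Q" for C
    using that by (auto simp: quotient_def fuzzy_class_def fuzzy_subgroups_def)
  have class_in: "fuzzy_class G \<mu> \<in> ?Q" if "fuzzy_subgroup G \<mu>" for \<mu>
    using that unfolding fuzzy_class_def by (auto simp: fuzzy_subgroups_def intro: quotientI)
  have inv_fuzzy: "fuzzy_subgroup G (gradual_to_fuzzy G \<sigma>)"
    and inv_class: "class_to_gradual G (fuzzy_class G (gradual_to_fuzzy G \<sigma>)) = \<sigma>"
    if "\<sigma> \<in> ?D" for \<sigma>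
    using that fuzzy_subgroup_gradual_to_fuzzy[of \<sigma>] fuzzy_to_gradual_gradual_to_fuzzy[of \<sigma>]
    by (simp_all add: decreasing_F_gradual_subgroups_def class_to_gradual_fuzzy_class)
  have inj: "inj_on (class_to_gradual G) ?Q"
  proof (rule inj_onI)
    fix C1 C2 assume "C1 \<in> ?Q" "C2 \<in> ?Q" and eq: "class_to_gradual G C1 = class_to_gradual G C2"
    then obtain \<mu>1 \<mu>2 where \<mu>: "fuzzy_subgroup G \<mu>1" "C1 = fuzzy_class G \<mu>1"
        "fuzzy_subgroup G \<mu>2" "C2 = fuzzy_class G \<mu>2"
      using class_cases by meson
    \<comment> \<open>Equal images of the classes mean equal level sets of the representatives,
      which is equivalence by the kernel description.\<close>
    then have "(\<mu>1, \<mu>2) \<in> fuzzy_equiv G"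
      using eq by (simp add: class_to_gradual_fuzzy_class fuzzy_equiv_iff)
    then show "C1 = C2"
      using \<mu> equiv_class_eq[OF equiv_fuzzy_equiv] by (simp add: fuzzy_class_def)
  qed
  moreover have "class_to_gradual G ` ?Q = ?D"
  proof (intro equalityI subsetI)
    fix \<sigma> assume "\<sigma> \<in> class_to_gradual G ` ?Q"
    then show "\<sigma> \<in> ?D"
      using fuzzy_to_gradual_in_decreasing_F_gradual_subgroups
      by (auto dest!: class_cases simp: class_to_gradual_fuzzy_class)
  next
    fix \<sigma> assume "\<sigma> \<in> ?D"
    then show "\<sigma> \<in> class_to_gradual G ` ?Q"
      using class_in[OF inv_fuzzy] inv_class by (metis image_eqI)
  qed
  ultimately have "bij_betw (class_to_gradual G) ?Q ?D"
    by (simp add: bij_betw_def)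
  moreover have "inv_into ?Q (class_to_gradual G) \<sigma> = fuzzy_class G (gradual_to_fuzzy G \<sigma>)"
    if "\<sigma> \<in> ?D" for \<sigma>
    \<comment> \<open>By injectivity, a single preimage in the quotient determines the inverse; the
      class of the reconstructed map is one.\<close>
    using inv_into_f_eq[OF inj class_in[OF inv_fuzzy[OF that]] inv_class[OF that]] .
  ultimately show ?thesis
    using equiv_fuzzy_equiv fuzzy_to_gradual_respects class_to_gradual_fuzzy_class inv_fuzzy
    by (auto simp: fuzzy_subgroups_def)
qed

end
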